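(* Let $c\ge 0$ and $p\ge 2$. Let $Y=(Y_1,\dots,Y_p)$ have independent components $Y_i\sim\mathrm{Poisson}(\theta_i)$ with $\theta\in(0,\infty)^p$ unknown, let $Z=\sum_{i=1}^pY_i$, and consider the loss function $$L_c(\theta,\delta)=\sum_{i=1}^p\frac{(\delta_i-\theta_i)^2}{\theta_i}+c\,\frac{\bigl(\sum_{i=1}^p\delta_i-\sum_{i=1}^p\theta_i\bigr)^2}{\sum_{i=1}^p\theta_i}.$$ (i) For each function $\phi$ on $\{0,1,2,\dots\}$ such that $$0<\phi(z)<\frac{2(p-1)}{p-1+(1+c)z}\quad\text{and}\quad \phi(z)z<\phi(z+1)(z+1)\quad\text{for all } z\in\{0,1,2,\dots\},$$ the estimator $\{1-\phi(Z)\}Y$ uniformly dominates $\delta_0(Y)=Y$ under $L_c$. (ii) The conditions in (i) are met by every function of the form $\phi(z)=\psi(z)/\{p-1+(1+c)z\}$ where $\psi$ is nondecreasing with $0<\psi(z)<2(p-1)$ for all $z$. (iii) In particular, $\delta_0(Y)=Y$ is inadmissible under $L_c$ if $p\ge 2$.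
   Context: The risk is $R_c(\delta,\theta)=\mathrm{E}_\theta L_c(\theta,\delta(Y))$. An estimator $\delta$ uniformly dominates $\delta_0$ if $R_c(\delta,\theta)<R_c(\delta_0,\theta)$ for all $\theta\in(0,\infty)^p$. An estimator is inadmissible if there is another estimator whose risk is nowhere larger and somewhere strictly smaller. *)

theory Defs
  imports "HOL-Probability.Probability"
begin

text \<open>
  Vectors of dimension \<open>p\<close> are functions on a finite index type \<open>'i\<close> with \<open>CARD('i) = p\<close>.
  The data space is discrete, so every function on it is measurable. Estimators take values in
  all of \<open>\<real>\<^sup>p\<close>: the shrinkage estimators below may have negative components.
\<close>

type_synonym 'i estimator = "('i \<Rightarrow> nat) \<Rightarrow> 'i \<Rightarrow> real"

definition loss :: "real \<Rightarrow> ('i::finite \<Rightarrow> real) \<Rightarrow> ('i \<Rightarrow> real) \<Rightarrow> real" where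
  "loss c \<theta> d = (\<Sum>i\<in>UNIV. (d i - \<theta> i)\<^sup>2 / \<theta> i)
     + c * ((\<Sum>i\<in>UNIV. d i) - (\<Sum>i\<in>UNIV. \<theta> i))\<^sup>2 / (\<Sum>i\<in>UNIV. \<theta> i)"

text \<open>The second argument of \<^const>\<open>Pi_pmf\<close> is a default value outside the index set; it plays
  no role here because the index set is \<^const>\<open>UNIV\<close>.\<close>

definition poisson_law :: "('i::finite \<Rightarrow> real) \<Rightarrow> ('i \<Rightarrow> nat) pmf" where
  "poisson_law \<theta> = Pi_pmf UNIV 0 (\<lambda>i. poisson_pmf (\<theta> i))"

lemma poisson_law_component:
  "map_pmf (\<lambda>y. y i) (poisson_law \<theta>) = poisson_pmf (\<theta> i)"
  by (simp add: poisson_law_def Pi_pmf_component)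

lemma poisson_law_indep:
  "prob_space.indep_vars (measure_pmf (poisson_law \<theta>)) (\<lambda>_. count_space UNIV) (\<lambda>i y. y i) UNIV"
  unfolding poisson_law_def by (rule indep_vars_Pi_pmf) simp

text \<open>The risk is an extended nonnegative expectation, so that an estimator whose loss is not
  integrable has risk \<open>\<infinity>\<close>; the Bochner integral would give it risk 0. The coercion
  \<^const>\<open>ennreal\<close> truncates nothing, since the loss is nonnegative for \<open>c \<ge> 0\<close> and \<open>\<theta> > 0\<close>.\<close>

definition risk :: "real \<Rightarrow> 'i::finite estimator \<Rightarrow> ('i \<Rightarrow> real) \<Rightarrow> ennreal" where
  "risk c \<delta> \<theta> = (\<integral>\<^sup>+ y. ennreal (loss c \<theta> (\<delta> y)) \<partial>measure_pmf (poisson_law \<theta>))"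

definition uniformly_dominates :: "real \<Rightarrow> 'i::finite estimator \<Rightarrow> 'i estimator \<Rightarrow> bool" where
  "uniformly_dominates c \<delta> \<delta>' \<longleftrightarrow> (\<forall>\<theta>. (\<forall>i. 0 < \<theta> i) \<longrightarrow> risk c \<delta> \<theta> < risk c \<delta>' \<theta>)"

definition inadmissible :: "real \<Rightarrow> 'i::finite estimator \<Rightarrow> bool" where
  "inadmissible c \<delta> \<longleftrightarrow> (\<exists>\<delta>'.
     (\<forall>\<theta>. (\<forall>i. 0 < \<theta> i) \<longrightarrow> risk c \<delta>' \<theta> \<le> risk c \<delta> \<theta>) \<and>
     (\<exists>\<theta>. (\<forall>i. 0 < \<theta> i) \<and> risk c \<delta>' \<theta> < risk c \<delta> \<theta>))"

definition usual_est :: "'i::finite estimator" where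
  "usual_est y = (\<lambda>i. real (y i))"

definition shrinkage_est :: "(nat \<Rightarrow> real) \<Rightarrow> 'i::finite estimator" where
  "shrinkage_est \<phi> y = (\<lambda>i. (1 - \<phi> (\<Sum>j\<in>UNIV. y j)) * real (y i))"

definition shrinkage_condition :: "real \<Rightarrow> nat \<Rightarrow> (nat \<Rightarrow> real) \<Rightarrow> bool" where
  "shrinkage_condition c p \<phi> \<longleftrightarrow> (\<forall>z.
     0 < \<phi> z \<and> \<phi> z < 2 * (real p - 1) / (real p - 1 + (1 + c) * real z) \<and>
     \<phi> z * real z < \<phi> (z + 1) * real (z + 1))"

end

theory Submission
  imports Defs
begin

text \<open>
  Write \<open>Z = \<Sum>\<^sub>i Y\<^sub>i\<close>, \<open>S = \<Sum>\<^sub>i \<theta>\<^sub>i\<close> and \<open>A = \<Sum>\<^sub>i Y\<^sub>i\<^sup>2 / \<theta>\<^sub>i + c Z\<^sup>2 / S\<close>. Expanding the squares shows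
  that replacing \<open>Y\<close> by \<open>(1 - \<phi>(Z)) Y\<close> changes the loss by
  \<open>(\<phi>(Z)\<^sup>2 - 2 \<phi>(Z)) A + 2 (1 + c) \<phi>(Z) Z\<close>, where only \<open>A\<close> depends on the unknown \<open>\<theta>\<close>
  (\<open>loss_shrinkage_est\<close>). The Poisson law satisfies the Stein-type identity
  \<open>E (Y\<^sub>i g(Y)) = \<theta>\<^sub>i E g(Y + e\<^sub>i)\<close>, which makes the unknown weights disappear:
  \<open>E (h(Z) A) = E (h(Z + 1) (Z + p + c (Z + 1)))\<close> for every nonnegative \<open>h\<close>
  (\<open>nn_integral_quadratic_form\<close>). Hence the risk difference is the expectation of a function of
  \<open>Z\<close> that is free of \<open>\<theta>\<close>. With \<open>w = Z + 1\<close> and \<open>p + Z + c (Z + 1) = p - 1 + (1 + c) w\<close>, the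
  growth condition \<open>\<phi>(Z) Z < \<phi>(w) w\<close> bounds that function strictly by
  \<open>\<phi>(w) (\<phi>(w) (p - 1 + (1 + c) w) - 2 (p - 1))\<close>, and this is negative by the upper bound on \<open>\<phi>\<close>
  (\<open>unbiased_risk_difference_neg\<close>).

  The argument is carried out with extended nonnegative integrals, the negative terms being moved
  to the other side. Finiteness of the risk of \<open>Y\<close> and of the term moved keeps the inequality
  strict and justifies the final cancellation; it follows from the same identity
  (\<open>nn_integral_quadratic_form_finite\<close>).
\<close>

section \<open>The Poisson shift identity\<close>

text \<open>
  The univariate weights satisfy \<open>(n + 1) pmf (n + 1) = r pmf n\<close>; the other factors of the product
  law are unaffected by a change of the \<open>i\<close>-th coordinate.
\<close>

lemma pmf_poisson_law_shift:
  fixes \<theta> :: "'i::finite \<Rightarrow> real"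
  assumes pos: "\<And>i. 0 < \<theta> i"
  shows "pmf (poisson_law \<theta>) (y(i := Suc (y i))) * real (Suc (y i)) = \<theta> i * pmf (poisson_law \<theta>) y"
proof -
  have pmf_prod: "pmf (poisson_law \<theta>) x =
      pmf (poisson_pmf (\<theta> i)) (x i) * (\<Prod>j\<in>UNIV - {i}. pmf (poisson_pmf (\<theta> j)) (x j))" for x
    unfolding poisson_law_def by (subst pmf_Pi) (auto intro: prod.remove)
  have others: "(\<Prod>j\<in>UNIV - {i}. pmf (poisson_pmf (\<theta> j)) ((y(i := Suc (y i))) j)) =
      (\<Prod>j\<in>UNIV - {i}. pmf (poisson_pmf (\<theta> j)) (y j))"
    by (intro prod.cong) auto
  have "pmf (poisson_pmf (\<theta> i)) (Suc (y i)) * real (Suc (y i)) =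
      \<theta> i * pmf (poisson_pmf (\<theta> i)) (y i)"
    using pos[of i] by (simp add: less_imp_le field_simps del: of_nat_Suc)
  then show ?thesis
    unfolding pmf_prod others by simp
qed

lemma nn_integral_poisson_law_shift:
  fixes \<theta> :: "'i::finite \<Rightarrow> real"
  assumes pos: "\<And>i. 0 < \<theta> i"
  shows "(\<integral>\<^sup>+ y. ennreal (real (y i)) * g y \<partial>measure_pmf (poisson_law \<theta>)) =
    ennreal (\<theta> i) * (\<integral>\<^sup>+ y. g (y(i := Suc (y i))) \<partial>measure_pmf (poisson_law \<theta>))"
proof -
  let ?P = "poisson_law \<theta>"
  let ?s = "\<lambda>y::'i \<Rightarrow> nat. y(i := Suc (y i))"
  have bij: "bij_betw ?s UNIV {y. y i \<noteq> 0}"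
  proof (rule bij_betwI[where g = "\<lambda>y. y(i := y i - 1)"])
  qed auto
  have "(\<integral>\<^sup>+ y. ennreal (real (y i)) * g y \<partial>measure_pmf ?P) =
      (\<integral>\<^sup>+ y. ennreal (pmf ?P y) * (ennreal (real (y i)) * g y) \<partial>count_space UNIV)"
    by (rule nn_integral_measure_pmf)
  also have "\<dots> =
      (\<integral>\<^sup>+ y. ennreal (pmf ?P y) * (ennreal (real (y i)) * g y) \<partial>count_space {y. y i \<noteq> 0})"
    \<comment> \<open>The factor \<open>y i\<close> kills every point outside the range of the shift.\<close>
    by (rule nn_integral_count_space_eq) auto
  also have "\<dots> =
      (\<integral>\<^sup>+ y. ennreal (pmf ?P (?s y)) * (ennreal (real (?s y i)) * g (?s y)) \<partial>count_space UNIV)"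
    by (rule nn_integral_bij_count_space[OF bij, symmetric])
  also have "\<dots> = (\<integral>\<^sup>+ y. ennreal (\<theta> i) * (ennreal (pmf ?P y) * g (?s y)) \<partial>count_space UNIV)"
  proof (rule nn_integral_cong)
    fix y :: "'i \<Rightarrow> nat"
    have "ennreal (pmf ?P (?s y)) * ennreal (real (?s y i)) = ennreal (\<theta> i) * ennreal (pmf ?P y)"
      using pmf_poisson_law_shift[OF pos, where y = y and i = i] pos[of i]
      by (simp add: ennreal_mult[symmetric] less_imp_le del: of_nat_Suc)
    then show "ennreal (pmf ?P (?s y)) * (ennreal (real (?s y i)) * g (?s y)) =
        ennreal (\<theta> i) * (ennreal (pmf ?P y) * g (?s y))"
      by (metis mult.assoc)
  qed
  also have "\<dots> = ennreal (\<theta> i) * (\<integral>\<^sup>+ y. g (?s y) \<partial>measure_pmf ?P)"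
    by (simp add: nn_integral_cmult nn_integral_measure_pmf)
  finally show ?thesis .
qed

text \<open>
  Both the first moment of \<open>Z\<close> and the quadratic form in the loss are sums of terms
  \<open>Y\<^sub>i g\<^sub>i(Y) / \<theta>\<^sub>i\<close>, so this normalised form of the shift identity serves for each of them.
\<close>

lemma nn_integral_poisson_law_shift_sum:
  fixes \<theta> :: "'i::finite \<Rightarrow> real"
  assumes pos: "\<And>i. 0 < \<theta> i" and nonneg: "\<And>i y. 0 \<le> g i y"
  shows "(\<integral>\<^sup>+ y. ennreal (\<Sum>i\<in>UNIV. real (y i) / \<theta> i * g i y) \<partial>measure_pmf (poisson_law \<theta>)) =
    (\<integral>\<^sup>+ y. ennreal (\<Sum>i\<in>UNIV. g i (y(i := Suc (y i)))) \<partial>measure_pmf (poisson_law \<theta>))"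
proof -
  let ?P = "measure_pmf (poisson_law \<theta>)"
  have summand: "(\<integral>\<^sup>+ y. ennreal (real (y i) / \<theta> i * g i y) \<partial>?P) =
      (\<integral>\<^sup>+ y. ennreal (g i (y(i := Suc (y i)))) \<partial>?P)" for i
  proof -
    have "(\<integral>\<^sup>+ y. ennreal (real (y i) / \<theta> i * g i y) \<partial>?P) =
        (\<integral>\<^sup>+ y. ennreal (real (y i)) * ennreal (g i y / \<theta> i) \<partial>?P)"
      using pos[of i] nonneg by (intro nn_integral_cong) (simp add: ennreal_mult[symmetric])
    also have "\<dots> = (\<integral>\<^sup>+ y. ennreal (\<theta> i) * ennreal (g i (y(i := Suc (y i))) / \<theta> i) \<partial>?P)"
      by (simp add: nn_integral_poisson_law_shift[OF pos] nn_integral_cmult)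
    also have "\<dots> = (\<integral>\<^sup>+ y. ennreal (g i (y(i := Suc (y i)))) \<partial>?P)"
      using pos[of i] nonneg
      by (intro nn_integral_cong) (simp add: ennreal_mult[symmetric] less_imp_le)
    finally show ?thesis .
  qed
  have terms_nonneg: "0 \<le> real (y i) / \<theta> i * g i y" for i y
    using pos[of i] nonneg[of i y] by simp
  have "(\<integral>\<^sup>+ y. ennreal (\<Sum>i\<in>UNIV. real (y i) / \<theta> i * g i y) \<partial>?P) =
      (\<Sum>i\<in>UNIV. \<integral>\<^sup>+ y. ennreal (real (y i) / \<theta> i * g i y) \<partial>?P)"
    using terms_nonneg by (subst nn_integral_sum[symmetric]) (simp_all)
  also have "\<dots> = (\<integral>\<^sup>+ y. ennreal (\<Sum>i\<in>UNIV. g i (y(i := Suc (y i)))) \<partial>?P)"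
    unfolding summand using nonneg by (subst nn_integral_sum[symmetric]) (simp_all)
  finally show ?thesis .
qed

lemma sum_fun_upd_Suc:
  fixes y :: "'i::finite \<Rightarrow> nat"
  shows "(\<Sum>j\<in>UNIV. (y(i := Suc (y i))) j) = Suc (\<Sum>j\<in>UNIV. y j)"
proof -
  have "(\<Sum>j\<in>UNIV - {i}. (y(i := Suc (y i))) j) = (\<Sum>j\<in>UNIV - {i}. y j)"
    by (intro sum.cong) auto
  then show ?thesis
    using sum.remove[OF finite UNIV_I, of "y(i := Suc (y i))" i]
      sum.remove[OF finite UNIV_I, of y i]
    by (simp only: fun_upd_same add_Suc)
qed

lemma nn_integral_total_poisson_law:
  fixes \<theta> :: "'i::finite \<Rightarrow> real"
  assumes pos: "\<And>i. 0 < \<theta> i"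
  shows "(\<integral>\<^sup>+ y. ennreal (real (\<Sum>i\<in>UNIV. y i)) \<partial>measure_pmf (poisson_law \<theta>)) =
    ennreal (\<Sum>i\<in>UNIV. \<theta> i)"
proof -
  let ?P = "measure_pmf (poisson_law \<theta>)"
  have "\<theta> i \<noteq> 0" for i
    using pos[of i] by simp
  then have "real (\<Sum>i\<in>UNIV. y i) = (\<Sum>i\<in>UNIV. real (y i) / \<theta> i * \<theta> i)" for y :: "'i \<Rightarrow> nat"
    by simp
  then have "(\<integral>\<^sup>+ y. ennreal (real (\<Sum>i\<in>UNIV. y i)) \<partial>?P) =
      (\<integral>\<^sup>+ y. ennreal (\<Sum>i\<in>UNIV. real (y i) / \<theta> i * \<theta> i) \<partial>?P)"
    by (simp only:)
  also have "\<dots> = (\<integral>\<^sup>+ y. ennreal (\<Sum>i\<in>UNIV. \<theta> i) \<partial>?P)"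
    by (rule nn_integral_poisson_law_shift_sum[where \<theta> = \<theta> and g = "\<lambda>i _. \<theta> i",
          OF pos less_imp_le[OF pos]])
  also have "\<dots> = ennreal (\<Sum>i\<in>UNIV. \<theta> i)"
    by (simp add: measure_pmf.emeasure_space_1)
  finally show ?thesis .
qed

section \<open>The risk of shrinkage estimators\<close>

definition quadratic_form :: "real \<Rightarrow> ('i::finite \<Rightarrow> real) \<Rightarrow> ('i \<Rightarrow> nat) \<Rightarrow> real" where
  "quadratic_form c \<theta> y =
    (\<Sum>i\<in>UNIV. (real (y i))\<^sup>2 / \<theta> i) + c * (real (\<Sum>i\<in>UNIV. y i))\<^sup>2 / (\<Sum>i\<in>UNIV. \<theta> i)"

lemma quadratic_form_nonneg:
  assumes "c \<ge> 0" "\<And>i. 0 < \<theta> i"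
  shows "0 \<le> quadratic_form c \<theta> y"
  using assms unfolding quadratic_form_def
  by (intro add_nonneg_nonneg sum_nonneg divide_nonneg_nonneg mult_nonneg_nonneg)
    (auto simp: less_imp_le)

lemma loss_nonneg:
  assumes "c \<ge> 0" "\<And>i. 0 < \<theta> i"
  shows "0 \<le> loss c \<theta> d"
  using assms unfolding loss_def
  by (intro add_nonneg_nonneg sum_nonneg divide_nonneg_nonneg mult_nonneg_nonneg)
    (auto simp: less_imp_le)

text \<open>
  Scaling the data by a constant, before the constant is allowed to depend on the total: both parts
  of the loss are quadratics in the scaling factor, and their cross terms
  \<open>2 (Y\<^sub>i / \<theta>\<^sub>i) \<theta>\<^sub>i\<close> and \<open>2 c (Z / S) S\<close> add up to a multiple of \<open>Z\<close> that is free of \<open>\<theta>\<close>.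
\<close>

lemma loss_scaled:
  fixes \<theta> :: "'i::finite \<Rightarrow> real"
  assumes pos: "\<And>i. 0 < \<theta> i"
  shows "loss c \<theta> (\<lambda>i. a * real (y i)) =
    a\<^sup>2 * quadratic_form c \<theta> y - 2 * (1 + c) * a * real (\<Sum>i\<in>UNIV. y i) + (1 + c) * (\<Sum>i\<in>UNIV. \<theta> i)"
proof -
  have S: "0 < (\<Sum>i\<in>UNIV. \<theta> i)"
    using pos by (intro sum_pos) auto
  have square: "(a * x - t)\<^sup>2 / t = a\<^sup>2 * (x\<^sup>2 / t) - 2 * a * x + t" if "t > 0" for x t :: real
    using that by (simp add: field_simps power2_eq_square)
  have componentwise: "(\<Sum>i\<in>UNIV. (a * real (y i) - \<theta> i)\<^sup>2 / \<theta> i) =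
      a\<^sup>2 * (\<Sum>i\<in>UNIV. (real (y i))\<^sup>2 / \<theta> i) - 2 * a * real (\<Sum>i\<in>UNIV. y i) + (\<Sum>i\<in>UNIV. \<theta> i)"
    unfolding square[OF pos] by (simp add: sum.distrib sum_subtractf sum_distrib_left)
  have total: "((\<Sum>i\<in>UNIV. a * real (y i)) - (\<Sum>i\<in>UNIV. \<theta> i))\<^sup>2 / (\<Sum>i\<in>UNIV. \<theta> i) =
      a\<^sup>2 * ((real (\<Sum>i\<in>UNIV. y i))\<^sup>2 / (\<Sum>i\<in>UNIV. \<theta> i)) - 2 * a * real (\<Sum>i\<in>UNIV. y i)
        + (\<Sum>i\<in>UNIV. \<theta> i)"
    using square[OF S, of "real (\<Sum>i\<in>UNIV. y i)"] by (simp add: sum_distrib_left)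
  show ?thesis
    unfolding loss_def quadratic_form_def times_divide_eq_right[symmetric] componentwise total
    by algebra
qed

text \<open>The change of the loss, arranged so that every term is nonnegative.\<close>

lemma loss_shrinkage_est:
  fixes \<theta> :: "'i::finite \<Rightarrow> real" and y :: "'i \<Rightarrow> nat"
  assumes pos: "\<And>i. 0 < \<theta> i"
  defines "Z \<equiv> \<Sum>i\<in>UNIV. y i"
  shows "loss c \<theta> (shrinkage_est \<phi> y) + 2 * \<phi> Z * quadratic_form c \<theta> y =
    loss c \<theta> (usual_est y) + ((\<phi> Z)\<^sup>2 * quadratic_form c \<theta> y + 2 * (1 + c) * \<phi> Z * real Z)"
  using loss_scaled[where \<theta> = \<theta> and c = c and a = "1 - \<phi> Z" and y = y, OF pos]
    loss_scaled[where \<theta> = \<theta> and c = c and a = 1 and y = y, OF pos]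
  unfolding shrinkage_est_def usual_est_def Z_def
  by (simp add: algebra_simps power2_eq_square)

text \<open>
  The quadratic form is \<open>\<Sum>\<^sub>i (Y\<^sub>i / \<theta>\<^sub>i) (Y\<^sub>i + c \<theta>\<^sub>i Z / S)\<close>, so the shift identity applies to it; after
  the shift the weights \<open>\<theta>\<^sub>i / S\<close> sum to one and \<open>\<theta>\<close> disappears.
\<close>

lemma nn_integral_quadratic_form:
  fixes \<theta> :: "'i::finite \<Rightarrow> real"
  assumes "c \<ge> 0" and pos: "\<And>i. 0 < \<theta> i" and nonneg: "\<And>z. 0 \<le> h z"
  shows "(\<integral>\<^sup>+ y. ennreal (h (\<Sum>i\<in>UNIV. y i) * quadratic_form c \<theta> y) \<partial>measure_pmf (poisson_law \<theta>)) =
    (\<integral>\<^sup>+ y. ennreal (h (Suc (\<Sum>i\<in>UNIV. y i)) *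
      (real CARD('i) - 1 + (1 + c) * real (Suc (\<Sum>i\<in>UNIV. y i)))) \<partial>measure_pmf (poisson_law \<theta>))"
proof -
  define S where "S = (\<Sum>i\<in>UNIV. \<theta> i)"
  have S: "0 < S"
    unfolding S_def using pos by (intro sum_pos) auto
  define g where "g i y = h (\<Sum>j\<in>UNIV. y j) * (real (y i) + c * \<theta> i * real (\<Sum>j\<in>UNIV. y j) / S)"
    for i and y :: "'i \<Rightarrow> nat"
  have g_nonneg: "0 \<le> g i y" for i y
    unfolding g_def using assms S less_imp_le[OF pos[of i]]
    by (intro mult_nonneg_nonneg add_nonneg_nonneg divide_nonneg_nonneg) (auto simp: sum_nonneg)
  have "h (\<Sum>i\<in>UNIV. y i) * quadratic_form c \<theta> y = (\<Sum>i\<in>UNIV. real (y i) / \<theta> i * g i y)"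
    for y :: "'i \<Rightarrow> nat"
  proof -
    let ?Z = "\<Sum>i\<in>UNIV. y i"
    have "real (y i) / \<theta> i * g i y =
        h ?Z * ((real (y i))\<^sup>2 / \<theta> i) + h ?Z * (c * real ?Z / S) * real (y i)" for i
      using pos[of i] S unfolding g_def by (simp add: field_simps power2_eq_square)
    then have "(\<Sum>i\<in>UNIV. real (y i) / \<theta> i * g i y) =
        h ?Z * (\<Sum>i\<in>UNIV. (real (y i))\<^sup>2 / \<theta> i) + h ?Z * (c * real ?Z / S) * real ?Z"
      by (simp add: sum.distrib sum_distrib_left)
    then show ?thesis
      unfolding quadratic_form_def S_def by (simp add: algebra_simps power2_eq_square)
  qed
  moreover have "(\<Sum>i\<in>UNIV. g i (y(i := Suc (y i)))) =
      h (Suc (\<Sum>i\<in>UNIV. y i)) * (real CARD('i) - 1 + (1 + c) * real (Suc (\<Sum>i\<in>UNIV. y i)))"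
    for y :: "'i \<Rightarrow> nat"
  proof -
    let ?W = "Suc (\<Sum>i\<in>UNIV. y i)"
    have "(\<Sum>i\<in>UNIV. g i (y(i := Suc (y i)))) =
        (\<Sum>i\<in>UNIV. h ?W * (real (y i) + 1 + c * real ?W / S * \<theta> i))"
      unfolding g_def sum_fun_upd_Suc by (intro sum.cong) (simp_all add: field_simps)
    also have "\<dots> = h ?W * (real (\<Sum>i\<in>UNIV. y i) + real CARD('i) + c * real ?W / S * S)"
      unfolding S_def
      by (simp only: sum_distrib_left[symmetric] sum.distrib of_nat_sum) simp
    also have "\<dots> = h ?W * (real CARD('i) - 1 + (1 + c) * real ?W)"
      using S by (simp add: field_simps)
    finally show ?thesis .
  qed
  ultimately show ?thesis
    using nn_integral_poisson_law_shift_sum[where \<theta> = \<theta> and g = g, OF pos g_nonneg]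
    by (simp only:)
qed

text \<open>
  The expected quadratic form is \<open>p + c + (1 + c) S\<close>, hence finite. The form with the constants \<open>a\<close>
  and \<open>b\<close> bounds both the loss of \<open>Y\<close> and, since \<open>\<phi> \<le> 2\<close>, the term \<open>2 \<phi>(Z) A\<close>.
\<close>

lemma nn_integral_quadratic_form_finite:
  fixes \<theta> :: "'i::finite \<Rightarrow> real"
  assumes "c \<ge> 0" and pos: "\<And>i. 0 < \<theta> i" and "a \<ge> 0" and "b \<ge> 0"
  shows "(\<integral>\<^sup>+ y. ennreal (a * quadratic_form c \<theta> y + b) \<partial>measure_pmf (poisson_law \<theta>)) < \<infinity>"
proof -
  let ?P = "measure_pmf (poisson_law \<theta>)"
  have "(\<integral>\<^sup>+ y. ennreal (a * quadratic_form c \<theta> y + b) \<partial>?P) =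
      (\<integral>\<^sup>+ y. ennreal (a * quadratic_form c \<theta> y) \<partial>?P) + ennreal b"
    using assms quadratic_form_nonneg[of c \<theta>]
    by (simp add: ennreal_plus nn_integral_add measure_pmf.emeasure_space_1)
  also have "(\<integral>\<^sup>+ y. ennreal (a * quadratic_form c \<theta> y) \<partial>?P) =
      (\<integral>\<^sup>+ y. ennreal (a * (real CARD('i) + c)
        + a * (1 + c) * real (\<Sum>i\<in>UNIV. y i)) \<partial>?P)"
    using nn_integral_quadratic_form[OF \<open>c \<ge> 0\<close> pos, of "\<lambda>_. a"] \<open>a \<ge> 0\<close>
    by (simp add: algebra_simps)
  also have "\<dots> = ennreal (a * (real CARD('i) + c)) +
      ennreal (a * (1 + c)) * (\<integral>\<^sup>+ y. ennreal (real (\<Sum>i\<in>UNIV. y i)) \<partial>?P)"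
    using assms
    by (simp add: ennreal_plus ennreal_mult nn_integral_add nn_integral_cmult
        measure_pmf.emeasure_space_1 del: of_nat_sum)
  also have "\<dots> < \<infinity>"
    unfolding nn_integral_total_poisson_law[OF pos] by (simp add: ennreal_mult_less_top)
  finally show ?thesis
    by simp
qed

section \<open>The shrinkage condition\<close>

text \<open>
  This is where the conditions on \<open>\<phi>\<close> enter: the integrand of the risk difference, free of \<open>\<theta>\<close>
  once the quadratic form has been integrated out, is negative at every point.
\<close>

lemma unbiased_risk_difference_neg:
  assumes "c \<ge> 0" "p \<ge> 2" and cond: "shrinkage_condition c p \<phi>"
  defines "B \<equiv> \<lambda>w. real p - 1 + (1 + c) * real w"
  shows "(\<phi> (Suc z))\<^sup>2 * B (Suc z) + 2 * (1 + c) * \<phi> z * real z < 2 * \<phi> (Suc z) * B (Suc z)"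
proof -
  let ?w = "Suc z"
  have B: "0 < B ?w"
    unfolding B_def using assms by (intro add_pos_nonneg) auto
  have pos: "0 < \<phi> ?w" and bound: "\<phi> ?w < 2 * (real p - 1) / B ?w"
    and growth: "\<phi> z * real z < \<phi> ?w * real ?w"
    using cond unfolding shrinkage_condition_def B_def by (auto simp del: of_nat_Suc)
  have "\<phi> ?w * B ?w < 2 * (real p - 1)"
    using bound B by (simp only: pos_less_divide_eq)
  then have "\<phi> ?w * (\<phi> ?w * B ?w) < \<phi> ?w * (2 * (real p - 1))"
    using pos by (rule mult_strict_left_mono)
  moreover have "2 * (1 + c) * (\<phi> z * real z) < 2 * (1 + c) * (\<phi> ?w * real ?w)"
    using growth \<open>c \<ge> 0\<close> by (intro mult_strict_left_mono) auto
  moreover have "2 * \<phi> ?w * B ?w = \<phi> ?w * (2 * (real p - 1)) + 2 * (1 + c) * (\<phi> ?w * real ?w)"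
    unfolding B_def by (simp add: algebra_simps)
  ultimately show ?thesis
    by (simp add: power2_eq_square mult.assoc)
qed

lemma shrinkage_condition_le_2:
  assumes "c \<ge> 0" "p \<ge> 2" "shrinkage_condition c p \<phi>"
  shows "\<phi> z \<le> 2"
proof -
  have "\<phi> z < 2 * (real p - 1) / (real p - 1 + (1 + c) * real z)"
    using assms unfolding shrinkage_condition_def by auto
  also have "\<dots> \<le> 2 * (real p - 1) / (real p - 1)"
    using assms by (intro divide_left_mono mult_pos_pos add_pos_nonneg) auto
  also have "\<dots> = 2"
    using \<open>p \<ge> 2\<close> by (intro nonzero_mult_div_cancel_right) simp
  finally show ?thesis
    by simp
qed

lemma shrinkage_est_dominates_usual_est:
  assumes "c \<ge> 0" and "CARD('i::finite) \<ge> 2" and cond: "shrinkage_condition c CARD('i) \<phi>"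
  shows "uniformly_dominates c (shrinkage_est \<phi> :: 'i estimator) usual_est"
  unfolding uniformly_dominates_def
proof (intro allI impI)
  fix \<theta> :: "'i \<Rightarrow> real"
  assume "\<forall>i. 0 < \<theta> i"
  then have pos: "\<And>i. 0 < \<theta> i"
    by blast
  let ?P = "measure_pmf (poisson_law \<theta>)"
  let ?Z = "\<lambda>y::'i \<Rightarrow> nat. \<Sum>i\<in>UNIV. y i"
  let ?A = "quadratic_form c \<theta>"
  let ?B = "\<lambda>w. real CARD('i) - 1 + (1 + c) * real w"
  have phi_pos: "0 < \<phi> z" for z
    using cond unfolding shrinkage_condition_def by blast
  have phi_le: "\<phi> z \<le> 2" for z
    using shrinkage_condition_le_2 assms by blast
  have A: "0 \<le> ?A y" for y
    using quadratic_form_nonneg assms(1) pos by blast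
  have B: "0 \<le> ?B w" for w
    using assms by (intro add_nonneg_nonneg) auto
  define gain where "gain = (\<integral>\<^sup>+ y. ennreal (2 * \<phi> (?Z y) * ?A y) \<partial>?P)"
  define cost where
    "cost = (\<integral>\<^sup>+ y. ennreal ((\<phi> (?Z y))\<^sup>2 * ?A y + 2 * (1 + c) * \<phi> (?Z y) * real (?Z y)) \<partial>?P)"

  have risk_eq: "risk c (shrinkage_est \<phi>) \<theta> + gain = risk c usual_est \<theta> + cost"
  proof -
    have "risk c (shrinkage_est \<phi>) \<theta> + gain =
        (\<integral>\<^sup>+ y. ennreal (loss c \<theta> (shrinkage_est \<phi> y) + 2 * \<phi> (?Z y) * ?A y) \<partial>?P)"
      unfolding risk_def gain_def
      using loss_nonneg[where \<theta> = \<theta>, OF assms(1) pos] A less_imp_le[OF phi_pos]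
      by (simp add: ennreal_plus nn_integral_add del: of_nat_sum)
    also have "\<dots> = (\<integral>\<^sup>+ y. ennreal (loss c \<theta> (usual_est y) +
        ((\<phi> (?Z y))\<^sup>2 * ?A y + 2 * (1 + c) * \<phi> (?Z y) * real (?Z y))) \<partial>?P)"
      by (simp only: loss_shrinkage_est[where \<theta> = \<theta>, OF pos])
    also have "\<dots> = (\<integral>\<^sup>+ y. ennreal (loss c \<theta> (usual_est y)) +
        ennreal ((\<phi> (?Z y))\<^sup>2 * ?A y + 2 * (1 + c) * \<phi> (?Z y) * real (?Z y)) \<partial>?P)"
      using loss_nonneg[where \<theta> = \<theta>, OF assms(1) pos] A less_imp_le[OF phi_pos] assms(1)
      by (intro nn_integral_cong ennreal_plus add_nonneg_nonneg mult_nonneg_nonneg)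
        (auto simp: sum_nonneg)
    also have "\<dots> = risk c usual_est \<theta> + cost"
      unfolding risk_def cost_def by (rule nn_integral_add) auto
    finally show ?thesis .
  qed

  have gain_finite: "gain < \<infinity>"
  proof -
    have "gain \<le> (\<integral>\<^sup>+ y. ennreal (4 * ?A y + 0) \<partial>?P)"
      unfolding gain_def
    proof (intro nn_integral_mono ennreal_leI)
      fix y
      show "2 * \<phi> (?Z y) * ?A y \<le> 4 * ?A y + 0"
        using mult_right_mono[OF phi_le[of "?Z y"] A[of y]] by linarith
    qed
    also have "\<dots> < \<infinity>"
      by (rule nn_integral_quadratic_form_finite[OF assms(1) pos]) auto
    finally show ?thesis .
  qed

  have risk_finite: "risk c usual_est \<theta> < \<infinity>"
  proof -
    have S: "0 \<le> (\<Sum>i\<in>UNIV. \<theta> i)"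
      using pos by (intro sum_nonneg) (auto simp: less_imp_le)
    have "risk c usual_est \<theta> \<le> (\<integral>\<^sup>+ y. ennreal (1 * ?A y + (1 + c) * (\<Sum>i\<in>UNIV. \<theta> i)) \<partial>?P)"
      unfolding risk_def
    proof (intro nn_integral_mono ennreal_leI)
      fix y
      have "0 \<le> 2 * (1 + c) * real (?Z y)"
        using assms(1) by (intro mult_nonneg_nonneg of_nat_0_le_iff) auto
      then show "loss c \<theta> (usual_est y) \<le> 1 * ?A y + (1 + c) * (\<Sum>i\<in>UNIV. \<theta> i)"
        using loss_scaled[where \<theta> = \<theta> and c = c and a = 1 and y = y, OF pos]
          unfolding usual_est_def by simp
    qed
    also have "\<dots> < \<infinity>"
      using S assms(1) by (intro nn_integral_quadratic_form_finite[OF assms(1) pos]) auto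
    finally show ?thesis .
  qed

  have cost_less_gain: "cost < gain"
  proof -
    let ?W = "\<lambda>y. Suc (?Z y)"
    let ?f = "\<lambda>y. (\<phi> (?W y))\<^sup>2 * ?B (?W y) + 2 * (1 + c) * \<phi> (?Z y) * real (?Z y)"
    let ?g = "\<lambda>y. 2 * \<phi> (?W y) * ?B (?W y)"
    have linear_nonneg: "0 \<le> 2 * (1 + c) * \<phi> (?Z y) * real (?Z y)" for y
      using assms(1) less_imp_le[OF phi_pos]
      by (intro mult_nonneg_nonneg of_nat_0_le_iff) auto
    have f_nonneg: "0 \<le> ?f y" for y
      by (intro add_nonneg_nonneg[OF mult_nonneg_nonneg[OF zero_le_power2 B] linear_nonneg])
    have "cost = (\<integral>\<^sup>+ y. ennreal ((\<phi> (?Z y))\<^sup>2 * ?A y) \<partial>?P) +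
        (\<integral>\<^sup>+ y. ennreal (2 * (1 + c) * \<phi> (?Z y) * real (?Z y)) \<partial>?P)"
      unfolding cost_def ennreal_plus[OF mult_nonneg_nonneg[OF zero_le_power2 A] linear_nonneg]
      by (rule nn_integral_add) auto
    also have "(\<integral>\<^sup>+ y. ennreal ((\<phi> (?Z y))\<^sup>2 * ?A y) \<partial>?P) =
        (\<integral>\<^sup>+ y. ennreal ((\<phi> (?W y))\<^sup>2 * ?B (?W y)) \<partial>?P)"
      by (rule nn_integral_quadratic_form[OF assms(1) pos]) auto
    also have "\<dots> + (\<integral>\<^sup>+ y. ennreal (2 * (1 + c) * \<phi> (?Z y) * real (?Z y)) \<partial>?P) =
        (\<integral>\<^sup>+ y. ennreal ((\<phi> (?W y))\<^sup>2 * ?B (?W y)) +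
          ennreal (2 * (1 + c) * \<phi> (?Z y) * real (?Z y)) \<partial>?P)"
      by (rule nn_integral_add[symmetric]) auto
    also have "\<dots> = (\<integral>\<^sup>+ y. ennreal (?f y) \<partial>?P)"
      by (intro nn_integral_cong ennreal_plus[symmetric] mult_nonneg_nonneg[OF zero_le_power2 B]
          linear_nonneg)
    finally have cost_eq: "cost = (\<integral>\<^sup>+ y. ennreal (?f y) \<partial>?P)" .
    have gain_eq: "gain = (\<integral>\<^sup>+ y. ennreal (?g y) \<partial>?P)"
      unfolding gain_def
      by (rule nn_integral_quadratic_form[OF assms(1) pos]) (simp add: phi_pos less_imp_le)
    have less: "ennreal (?f y) < ennreal (?g y)" for y
      using unbiased_risk_difference_neg[OF assms, of "?Z y"] f_nonneg[of y]
      by (simp only: ennreal_less_iff)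
    have f_le_gain: "(\<integral>\<^sup>+ y. ennreal (?f y) \<partial>?P) \<le> gain"
      unfolding gain_eq by (intro nn_integral_mono less_imp_le less)
    have "(\<integral>\<^sup>+ y. ennreal (?f y) \<partial>?P) < (\<integral>\<^sup>+ y. ennreal (?g y) \<partial>?P)"
    proof (intro nn_integral_less)
      show "(\<integral>\<^sup>+ y. ennreal (?f y) \<partial>?P) \<noteq> \<infinity>"
        using le_less_trans[OF f_le_gain gain_finite] by (rule less_imp_neq)
      show "AE y in ?P. ennreal (?f y) \<le> ennreal (?g y)"
        by (rule AE_I2) (rule less_imp_le[OF less])
      show "\<not> (AE y in ?P. ennreal (?g y) \<le> ennreal (?f y))"
        using less set_pmf_not_empty[of "poisson_law \<theta>"]
        unfolding AE_measure_pmf_iff not_le[symmetric] by blast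
    qed simp_all
    then show ?thesis
      unfolding cost_eq gain_eq .
  qed

  have "risk c (shrinkage_est \<phi>) \<theta> + gain < risk c usual_est \<theta> + gain"
    unfolding risk_eq using cost_less_gain risk_finite
    by (simp add: ennreal_add_left_cancel_less)
  then show "risk c (shrinkage_est \<phi>) \<theta> < risk c usual_est \<theta>"
    by (meson add_right_mono not_le)
qed

text \<open>
  Multiplying by \<open>z\<close> turns \<open>1 / (p - 1 + (1 + c) z)\<close> into a strictly increasing function of \<open>z\<close>,
  since \<open>p > 1\<close>; a nondecreasing positive factor preserves this.
\<close>

lemma shrinkage_condition_mono:
  assumes "c \<ge> 0" "p \<ge> 2" "mono \<psi>" and bounds: "\<And>z. 0 < \<psi> z \<and> \<psi> z < 2 * (real p - 1)"
  shows "shrinkage_condition c p (\<lambda>z. \<psi> z / (real p - 1 + (1 + c) * real z))"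
proof -
  define B where "B z = real p - 1 + (1 + c) * real z" for z
  have B: "0 < B z" for z
    unfolding B_def using assms by (intro add_pos_nonneg) auto
  have "\<psi> z / B z * real z < \<psi> (z + 1) / B (z + 1) * real (z + 1)" for z
  proof -
    have "real z * B (z + 1) < real (z + 1) * B z"
      unfolding B_def using assms by (simp add: algebra_simps)
    then have "real z / B z < real (z + 1) / B (z + 1)"
      using B by (simp add: frac_less_eq divide_simps)
    then have "\<psi> z * (real z / B z) < \<psi> z * (real (z + 1) / B (z + 1))"
      using bounds by (intro mult_strict_left_mono) auto
    also have "\<dots> \<le> \<psi> (z + 1) * (real (z + 1) / B (z + 1))"
      using \<open>mono \<psi>\<close> less_imp_le[OF B] by (intro mult_right_mono) (auto simp: mono_def)
    finally show ?thesis
      by simp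
  qed
  moreover have "0 < \<psi> z / B z" "\<psi> z / B z < 2 * (real p - 1) / B z" for z
    using bounds B by (auto intro: divide_strict_right_mono)
  ultimately show ?thesis
    unfolding shrinkage_condition_def B_def by blast
qed

theorem theorem2:
  fixes c :: real
  assumes "c \<ge> 0" and "CARD('i::finite) \<ge> 2"
  shows "(\<forall>\<phi>. shrinkage_condition c CARD('i) \<phi> \<longrightarrow>
            uniformly_dominates c (shrinkage_est \<phi> :: 'i estimator) usual_est)
       \<and> (\<forall>\<psi> :: nat \<Rightarrow> real. mono \<psi> \<and> (\<forall>z. 0 < \<psi> z \<and> \<psi> z < 2 * (real CARD('i) - 1)) \<longrightarrow>
            shrinkage_condition c CARD('i)
              (\<lambda>z. \<psi> z / (real CARD('i) - 1 + (1 + c) * real z)))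
       \<and> inadmissible c (usual_est :: 'i estimator)"
proof (intro conjI allI impI)
  show "uniformly_dominates c (shrinkage_est \<phi> :: 'i estimator) usual_est"
    if "shrinkage_condition c CARD('i) \<phi>" for \<phi>
    using shrinkage_est_dominates_usual_est assms that by blast
  show "shrinkage_condition c CARD('i) (\<lambda>z. \<psi> z / (real CARD('i) - 1 + (1 + c) * real z))"
    if "mono \<psi> \<and> (\<forall>z. 0 < \<psi> z \<and> \<psi> z < 2 * (real CARD('i) - 1))" for \<psi> :: "nat \<Rightarrow> real"
    using shrinkage_condition_mono assms that by blast
  show "inadmissible c (usual_est :: 'i estimator)"
  proof -
    \<comment> \<open>The constant \<open>\<psi> = p - 1\<close> lies midway in the admissible range \<open>(0, 2 (p - 1))\<close>.\<close>
    define \<phi> where "\<phi> z = (real CARD('i) - 1) / (real CARD('i) - 1 + (1 + c) * real z)" for z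
    have "shrinkage_condition c CARD('i) \<phi>"
      unfolding \<phi>_def using assms by (intro shrinkage_condition_mono) (auto simp: mono_def)
    then have "uniformly_dominates c (shrinkage_est \<phi> :: 'i estimator) usual_est"
      using shrinkage_est_dominates_usual_est assms by blast
    then have less: "risk c (shrinkage_est \<phi>) \<theta> < risk c usual_est \<theta>"
      if "\<forall>i. 0 < \<theta> i" for \<theta> :: "'i \<Rightarrow> real"
      using that unfolding uniformly_dominates_def by blast
    show ?thesis
      unfolding inadmissible_def
    proof (intro exI[of _ "shrinkage_est \<phi>"] conjI allI impI)
      show "risk c (shrinkage_est \<phi>) \<theta> \<le> risk c usual_est \<theta>"
        if "\<forall>i. 0 < \<theta> i" for \<theta> :: "'i \<Rightarrow> real"
        using less[OF that] by (rule less_imp_le)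
      show "\<exists>\<theta>::'i \<Rightarrow> real. (\<forall>i. 0 < \<theta> i) \<and> risk c (shrinkage_est \<phi>) \<theta> < risk c usual_est \<theta>"
        using less[of "\<lambda>_. 1"] by (intro exI[of _ "\<lambda>_. 1"]) simp
    qed
  qed
qed

end
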